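(* Let $\theta\in\mathbb{S}^n$, let $r_j\ge 0$ for all $j\in\mathcal{N}=\{1,\dots,n\}$, and let $\mathcal{H}\subseteq\mathcal{N}$ induce an isolated subgraph in the graphical representation of the Ising model with parameters $\theta$ (that is, $\theta_{ij}=0$ for all $i\in\mathcal{H}$, $j\in\mathcal{N}\setminus\mathcal{H}$). If product $k\in\mathcal{H}$ is such that $\theta_{ki}=\alpha r_i$ for all $i\in\mathcal{H}\setminus\{k\}$, where $\alpha$ is an arbitrary positive constant, then product $k$ belongs to the optimal assortment: there is an optimal solution $S^*$ of $\max_{S\subseteq\mathcal{N}}R(S)$ with $k\in S^*$.
   Context: Let $\mathcal{N}=\{1,\dots,n\}$ be a set of products and $\theta\in\mathbb{S}^n$ a real symmetric $n\times n$ matrix. An assortment is a subset $S\subseteq\mathcal{N}$; a basket from $S$ is a vector $x\in\mathcal{X}(S)=\{0,1\}^{S}$. Under the (binary) Ising model with parameters $\theta$, the probability that a random customer offered $S$ selects basket $x$ is $$p_\theta(x\mid S)=\frac{\exp\bigl(\sum_{i\in S}\theta_{ii}x_i+\sum_{i\ne j,\ i,j\in S}x_i\theta_{ij}x_j\bigr)}{\sum_{y\in\mathcal{X}(S)}\exp\bigl(\sum_{i\in S}\theta_{ii}y_i+\sum_{i\ne j,\ i,j\in S}y_i\theta_{ij}y_j\bigr)},$$ where the sum over $i\ne j$ runs over ordered pairs. With $r_j$ the gross profit (or revenue) per unit of product $j$, the expected profit of assortment $S$ is $R(S)=\sum_{x\in\mathcal{X}(S)}p_\theta(x\mid S)\sum_{j\in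 S}r_jx_j$. The graphical representation of the model is the weighted graph on $\mathcal{N}$ in which distinct $i,j$ are joined by an edge of weight $\theta_{ij}$ iff $\theta_{ij}\ne 0$. *)

theory Defs
  imports "HOL-Analysis.Analysis"
begin

text \<open>The products are the elements of the finite index type \<open>'n\<close> (so \<open>n = CARD('n)\<close>), and
  an assortment is an arbitrary set of products.\<close>

text \<open>The vectors in \<open>{0,1}\<^sup>S\<close> are functions that are \<open>undefined\<close> outside \<open>S\<close>, so that
  each basket is counted exactly once in a sum over \<open>baskets S\<close>.\<close>

definition baskets :: "'n set \<Rightarrow> ('n \<Rightarrow> real) set"
  where "baskets S = S \<rightarrow>\<^sub>E {0, 1}"

text \<open>The interaction sum ranges over ordered pairs: each unordered pair \<open>{i, j}\<close> counts twice.\<close>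

definition ising_exponent :: "real^'n^'n \<Rightarrow> 'n set \<Rightarrow> ('n \<Rightarrow> real) \<Rightarrow> real"
  where "ising_exponent \<theta> S x =
    (\<Sum>i\<in>S. \<theta> $ i $ i * x i) + (\<Sum>i\<in>S. \<Sum>j\<in>S - {i}. x i * \<theta> $ i $ j * x j)"

definition ising_prob :: "real^'n^'n \<Rightarrow> 'n set \<Rightarrow> ('n \<Rightarrow> real) \<Rightarrow> real"
  where "ising_prob \<theta> S x =
    exp (ising_exponent \<theta> S x) / (\<Sum>y\<in>baskets S. exp (ising_exponent \<theta> S y))"

definition expected_profit :: "real^'n^'n \<Rightarrow> real^'n \<Rightarrow> 'n set \<Rightarrow> real"
  where "expected_profit \<theta> r S = (\<Sum>x\<in>baskets S. ising_prob \<theta> S x * (\<Sum>j\<in>S. r $ j * x j))"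

definition optimal_assortment :: "real^'n^'n \<Rightarrow> real^'n \<Rightarrow> 'n set \<Rightarrow> bool"
  where "optimal_assortment \<theta> r S \<longleftrightarrow> (\<forall>T. expected_profit \<theta> r T \<le> expected_profit \<theta> r S)"

definition ising_edge :: "real^'n^'n \<Rightarrow> 'n \<Rightarrow> 'n \<Rightarrow> bool"
  where "ising_edge \<theta> i j \<longleftrightarrow> i \<noteq> j \<and> \<theta> $ i $ j \<noteq> 0"

text \<open>Isolated means disconnected from the remaining vertices; \<open>H\<close> itself need not be
  connected.\<close>

definition induces_isolated_subgraph :: "real^'n^'n \<Rightarrow> 'n set \<Rightarrow> bool"
  where "induces_isolated_subgraph \<theta> H \<longleftrightarrow> (\<forall>i\<in>H. \<forall>j\<in>- H. \<not> ising_edge \<theta> i j)"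

end

theory Submission
  imports Defs
begin

text \<open>
  Adding \<open>k\<close> to an assortment \<open>S\<close> never lowers the expected profit, so \<open>k\<close> can be added to any
  optimal assortment.

  Let \<open>k \<notin> S\<close>, let \<open>w\<close> be the Ising weight of a basket from \<open>S\<close>, and let \<open>f\<close> be its profit. Baskets
  without \<open>k\<close> keep their weight in \<open>insert k S\<close>. Adding \<open>k\<close> to a basket \<open>x\<close> multiplies its weight
  by \<open>c * \<phi> x\<close>, where \<open>c = exp \<theta>\<^sub>k\<^sub>k\<close> and \<open>\<phi> x = exp (2 * (\<Sum>i\<in>S. \<theta>\<^sub>k\<^sub>i * x\<^sub>i))\<close>. Hence the new expected
  profit is a mixture of the old one and of \<open>r\<^sub>k\<close> plus the mean of \<open>f\<close> under the tilted weight
  \<open>w * \<phi>\<close>. As \<open>r\<^sub>k \<ge> 0\<close>, it suffices that this tilted mean is at least the mean under \<open>w\<close>, which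
  says that \<open>\<phi>\<close> and \<open>f\<close> have nonnegative covariance under \<open>w\<close>
  (lemma \<open>expected_profit_le_insert\<close>).

  The hypotheses on \<open>H\<close> give \<open>\<phi> = exp (2 * \<alpha> * g)\<close>, where \<open>g\<close> is the profit earned on \<open>S \<inter> H\<close>.
  Split \<open>f = g + h\<close>, with \<open>h\<close> the profit earned on \<open>S - H\<close>. The covariance of \<open>\<phi>\<close> and \<open>g\<close> is
  nonnegative because \<open>\<phi>\<close> is an increasing function of \<open>g\<close> (Chebyshev's inequality), and the
  covariance of \<open>\<phi>\<close> and \<open>h\<close> vanishes because the parts of a basket inside and outside \<open>H\<close> are
  independent.

  Both covariances are read off from their representation as a double sum over two independent
  copies \<open>x, y\<close> of the basket. In this form independence becomes a symmetry: exchanging the parts of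
  \<open>x\<close> and \<open>y\<close> outside \<open>H\<close> preserves the joint weight and \<open>\<phi> x - \<phi> y\<close>, but reverses the sign of
  \<open>h x - h y\<close>.
\<close>

section \<open>Weighted covariances as double sums\<close>

lemma double_sum_covariance:
  fixes w f g :: "'a \<Rightarrow> real"
  shows "(\<Sum>x\<in>A. \<Sum>y\<in>A. w x * w y * ((f x - f y) * (g x - g y))) =
    2 * ((\<Sum>x\<in>A. w x) * (\<Sum>x\<in>A. w x * f x * g x) - (\<Sum>x\<in>A. w x * f x) * (\<Sum>x\<in>A. w x * g x))"
proof -
  have "(\<Sum>x\<in>A. \<Sum>y\<in>A. w x * w y * ((f x - f y) * (g x - g y))) =
    (\<Sum>x\<in>A. \<Sum>y\<in>A. (w x * f x * g x) * w y + w x * (w y * f y * g y)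
       - (w x * f x) * (w y * g y) - (w x * g x) * (w y * f y))"
    by (intro sum.cong refl) (simp add: algebra_simps)
  also have "\<dots> = (\<Sum>x\<in>A. w x * f x * g x) * (\<Sum>y\<in>A. w y) + (\<Sum>x\<in>A. w x) * (\<Sum>y\<in>A. w y * f y * g y)
     - (\<Sum>x\<in>A. w x * f x) * (\<Sum>y\<in>A. w y * g y) - (\<Sum>x\<in>A. w x * g x) * (\<Sum>y\<in>A. w y * f y)"
    by (simp only: sum.distrib sum_subtractf sum_product)
  finally show ?thesis
    by (simp add: algebra_simps)
qed

text \<open>Used with an involution that exchanges two independent copies of one component of a random
  element: the terms of the sum cancel in pairs.\<close>

lemma sum_eq_0_by_involution:
  fixes F :: "'a \<Rightarrow> real"
  assumes "\<And>x. x \<in> A \<Longrightarrow> \<tau> x \<in> A"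
    and "\<And>x. x \<in> A \<Longrightarrow> \<tau> (\<tau> x) = x"
    and "\<And>x. x \<in> A \<Longrightarrow> F (\<tau> x) = - F x"
  shows "sum F A = 0"
proof -
  have "sum F A = (\<Sum>x\<in>A. F (\<tau> x))"
    by (rule sum.reindex_bij_witness[where i = \<tau> and j = \<tau>]) (simp_all add: assms(1,2))
  also have "\<dots> = - sum F A"
    using assms(3) by (simp add: sum_negf)
  finally show ?thesis by simp
qed

section \<open>Baskets and their weights\<close>

lemma finite_baskets [simp]: "finite (baskets (S :: 'n::finite set))"
  by (simp add: baskets_def finite_PiE)

lemma baskets_nonempty: "baskets S \<noteq> {}"
  by (simp add: baskets_def PiE_eq_empty_iff)

lemma baskets_values: "x \<in> baskets S \<Longrightarrow> i \<in> S \<Longrightarrow> x i \<in> {0, 1}"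
  by (auto simp: baskets_def)

lemma sum_baskets_insert:
  fixes G :: "('n::finite \<Rightarrow> real) \<Rightarrow> real"
  assumes "k \<notin> S"
  shows "(\<Sum>x\<in>baskets (insert k S). G x) = (\<Sum>x\<in>baskets S. G (x(k := 0)) + G (x(k := 1)))"
proof -
  have "(\<Sum>x\<in>baskets (insert k S). G x) = (\<Sum>(a, x)\<in>{0, 1} \<times> baskets S. G (x(k := a)))"
    unfolding baskets_def PiE_insert_eq using assms
    by (subst sum.reindex) (auto intro!: inj_combinator sum.cong)
  also have "\<dots> = (\<Sum>a\<in>{0, 1}. \<Sum>x\<in>baskets S. G (x(k := a)))"
    by (simp add: sum.cartesian_product)
  finally show ?thesis
    by (simp add: sum.distrib)
qed

text \<open>Since \<open>x\<^sub>i\<^sup>2 = x\<^sub>i\<close>, the linear part of the exponent supplies the diagonal of the quadratic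
  form. This removes the exception \<open>j \<noteq> i\<close>, which is awkward when the index set is split.\<close>

lemma ising_exponent_quadratic_form:
  fixes S :: "'n::finite set"
  assumes "\<And>i. i \<in> S \<Longrightarrow> x i \<in> {0, 1}"
  shows "ising_exponent \<theta> S x = (\<Sum>i\<in>S. \<Sum>j\<in>S. x i * \<theta> $ i $ j * x j)"
proof -
  have "\<theta> $ i $ i * x i + (\<Sum>j\<in>S - {i}. x i * \<theta> $ i $ j * x j) = (\<Sum>j\<in>S. x i * \<theta> $ i $ j * x j)"
    if "i \<in> S" for i
    using assms[OF that] that by (auto simp: sum.remove[of S i])
  then show ?thesis
    unfolding ising_exponent_def by (simp flip: sum.distrib)
qed

lemma ising_exponent_cong:
  assumes "\<And>i. i \<in> S \<Longrightarrow> x i = y i"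
  shows "ising_exponent \<theta> S x = ising_exponent \<theta> S y"
  unfolding ising_exponent_def using assms by (auto intro!: arg_cong2[of _ _ _ _ "(+)"] sum.cong)

lemma ising_exponent_union:
  fixes A B :: "'n::finite set"
  assumes "\<And>i. i \<in> A \<union> B \<Longrightarrow> x i \<in> {0, 1}" and "A \<inter> B = {}"
    and "\<And>i j. i \<in> A \<Longrightarrow> j \<in> B \<Longrightarrow> \<theta> $ i $ j = 0 \<and> \<theta> $ j $ i = 0"
  shows "ising_exponent \<theta> (A \<union> B) x = ising_exponent \<theta> A x + ising_exponent \<theta> B x"
proof -
  let ?q = "\<lambda>i j. x i * \<theta> $ i $ j * x j"
  have "(\<Sum>i\<in>A. \<Sum>j\<in>B. ?q i j) = 0" "(\<Sum>i\<in>B. \<Sum>j\<in>A. ?q i j) = 0"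
    using assms(3) by (auto intro!: sum.neutral)
  moreover have "(\<Sum>i\<in>A \<union> B. \<Sum>j\<in>A \<union> B. ?q i j) =
      (\<Sum>i\<in>A. \<Sum>j\<in>A. ?q i j) + (\<Sum>i\<in>A. \<Sum>j\<in>B. ?q i j)
      + ((\<Sum>i\<in>B. \<Sum>j\<in>A. ?q i j) + (\<Sum>i\<in>B. \<Sum>j\<in>B. ?q i j))"
    using assms(2) by (simp add: sum.union_disjoint sum.distrib)
  moreover have "ising_exponent \<theta> C x = (\<Sum>i\<in>C. \<Sum>j\<in>C. ?q i j)" if "C \<subseteq> A \<union> B" for C
    by (rule ising_exponent_quadratic_form) (use assms(1) that in auto)
  ultimately show ?thesis by simp
qed

text \<open>The pair \<open>{k, i}\<close> enters the exponent in both orders; symmetry of \<open>\<theta>\<close> merges the two terms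
  into the factor \<open>2\<close>.\<close>

lemma ising_exponent_insert:
  fixes S :: "'n::finite set"
  assumes "transpose \<theta> = \<theta>" and "k \<notin> S" and "x \<in> baskets S" and "a \<in> {0, 1}"
  shows "ising_exponent \<theta> (insert k S) (x(k := a)) =
    ising_exponent \<theta> S x + a * (\<theta> $ k $ k + 2 * (\<Sum>i\<in>S. \<theta> $ k $ i * x i))"
proof -
  have sym: "\<theta> $ i $ j = \<theta> $ j $ i" for i j
    using assms(1) by (metis transpose_def vec_lambda_beta)
  have upd: "(x(k := a)) i = x i" if "i \<in> S" for i
    using that assms(2) by auto
  let ?q = "\<lambda>i j. (x(k := a)) i * \<theta> $ i $ j * (x(k := a)) j"
  have "ising_exponent \<theta> (insert k S) (x(k := a)) = (\<Sum>i\<in>insert k S. \<Sum>j\<in>insert k S. ?q i j)"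
    by (rule ising_exponent_quadratic_form) (use assms(2,4) baskets_values[OF assms(3)] in auto)
  also have "\<dots> = ?q k k + (\<Sum>j\<in>S. ?q k j) + ((\<Sum>i\<in>S. ?q i k) + (\<Sum>i\<in>S. \<Sum>j\<in>S. ?q i j))"
    using assms(2) by (simp only: sum.insert finite not_False_eq_True sum.distrib)
  also have "(\<Sum>j\<in>S. ?q k j) = a * (\<Sum>i\<in>S. \<theta> $ k $ i * x i)"
    unfolding sum_distrib_left by (intro sum.cong refl) (use upd in \<open>simp add: mult_ac\<close>)
  also have "(\<Sum>i\<in>S. ?q i k) = a * (\<Sum>i\<in>S. \<theta> $ k $ i * x i)"
    unfolding sum_distrib_left
  proof (intro sum.cong refl)
    fix i assume "i \<in> S"
    then show "?q i k = a * (\<theta> $ k $ i * x i)"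
      using upd sym[of i k] by (simp add: mult_ac)
  qed
  also have "(\<Sum>i\<in>S. \<Sum>j\<in>S. ?q i j) = (\<Sum>i\<in>S. \<Sum>j\<in>S. x i * \<theta> $ i $ j * x j)"
    by (intro sum.cong refl) (use upd in simp)
  also have "\<dots> = ising_exponent \<theta> S x"
    using assms(3) baskets_values by (intro ising_exponent_quadratic_form[symmetric])
  also have "?q k k = a * \<theta> $ k $ k"
    using assms(4) by auto
  finally show ?thesis
    by (simp add: algebra_simps fun_upd_def)
qed

section \<open>Adding a product to an assortment\<close>

lemma expected_profit_eq_quotient:
  "expected_profit \<theta> r S =
    (\<Sum>x\<in>baskets S. exp (ising_exponent \<theta> S x) * (\<Sum>j\<in>S. r $ j * x j))
    / (\<Sum>x\<in>baskets S. exp (ising_exponent \<theta> S x))"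
  unfolding expected_profit_def ising_prob_def by (simp add: sum_divide_distrib)

text \<open>The covariance condition compares the mean profit of a basket that received \<open>k\<close> with that of
  a basket from \<open>S\<close>. The factor \<open>exp \<theta>\<^sub>k\<^sub>k\<close> only changes the proportions in which the two means
  are mixed.\<close>

lemma expected_profit_le_insert:
  fixes \<theta> :: "real^'n^'n" and r :: "real^'n" and S :: "'n set" and k :: 'n
  defines "w \<equiv> \<lambda>x. exp (ising_exponent \<theta> S x)"
    and "\<phi> \<equiv> \<lambda>x. exp (2 * (\<Sum>i\<in>S. \<theta> $ k $ i * x i))"
    and "f \<equiv> \<lambda>x. \<Sum>j\<in>S. r $ j * x j"
  assumes "transpose \<theta> = \<theta>" and "r $ k \<ge> 0" and "k \<notin> S"
    and cov: "(\<Sum>x\<in>baskets S. w x * \<phi> x) * (\<Sum>x\<in>baskets S. w x * f x)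
      \<le> (\<Sum>x\<in>baskets S. w x) * (\<Sum>x\<in>baskets S. w x * \<phi> x * f x)"
  shows "expected_profit \<theta> r S \<le> expected_profit \<theta> r (insert k S)"
proof -
  define c where "c = exp (\<theta> $ k $ k)"
  define Z where "Z = (\<Sum>x\<in>baskets S. w x)"
  define Zk where "Zk = (\<Sum>x\<in>baskets S. w x * \<phi> x)"
  define F where "F = (\<Sum>x\<in>baskets S. w x * f x)"
  define Fk where "Fk = (\<Sum>x\<in>baskets S. w x * \<phi> x * f x)"
  have weight0: "exp (ising_exponent \<theta> (insert k S) (x(k := 0))) = w x"
    and weight1: "exp (ising_exponent \<theta> (insert k S) (x(k := 1))) = c * (w x * \<phi> x)"
    if "x \<in> baskets S" for x
    using ising_exponent_insert[OF assms(4) \<open>k \<notin> S\<close> that]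
    by (simp_all add: w_def \<phi>_def c_def exp_add)
  have profit: "(\<Sum>j\<in>insert k S. r $ j * (x(k := a)) j) = r $ k * a + f x" for x a
  proof -
    have "(\<Sum>j\<in>S. r $ j * (x(k := a)) j) = f x"
      unfolding f_def by (intro sum.cong refl) (use \<open>k \<notin> S\<close> in auto)
    then show ?thesis
      using \<open>k \<notin> S\<close> by simp
  qed
  have "(\<Sum>x\<in>baskets (insert k S). exp (ising_exponent \<theta> (insert k S) x))
      = (\<Sum>x\<in>baskets S. w x + c * (w x * \<phi> x))"
    by (simp only: sum_baskets_insert[OF \<open>k \<notin> S\<close>] weight0 weight1 cong: sum.cong)
  also have "\<dots> = Z + c * Zk"
    by (simp add: Z_def Zk_def sum.distrib sum_distrib_left)
  finally have den: "(\<Sum>x\<in>baskets (insert k S). exp (ising_exponent \<theta> (insert k S) x)) = Z + c * Zk" .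
  have "(\<Sum>x\<in>baskets (insert k S). exp (ising_exponent \<theta> (insert k S) x)
          * (\<Sum>j\<in>insert k S. r $ j * x j))
      = (\<Sum>x\<in>baskets S. w x * f x + c * (w x * \<phi> x * f x) + c * r $ k * (w x * \<phi> x))"
    unfolding sum_baskets_insert[OF \<open>k \<notin> S\<close>] profit
    by (intro sum.cong refl) (simp add: weight0 weight1[simplified] algebra_simps)
  also have "\<dots> = F + c * Fk + c * r $ k * Zk"
    by (simp add: F_def Fk_def Zk_def sum.distrib sum_distrib_left)
  finally have num: "(\<Sum>x\<in>baskets (insert k S). exp (ising_exponent \<theta> (insert k S) x)
          * (\<Sum>j\<in>insert k S. r $ j * x j)) = F + c * Fk + c * r $ k * Zk" .
  have pos: "Z > 0" "Zk > 0" "c > 0"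
    unfolding Z_def Zk_def c_def w_def \<phi>_def by (auto intro!: sum_pos simp: baskets_nonempty)
  have "F * (Z + c * Zk) \<le> (F + c * Fk + c * r $ k * Zk) * Z"
  proof -
    have "c * (Zk * F) \<le> c * (Z * Fk)"
      using cov pos by (simp add: Z_def Zk_def F_def Fk_def)
    moreover have "0 \<le> c * r $ k * Zk * Z"
      using pos \<open>r $ k \<ge> 0\<close> by simp
    ultimately show ?thesis
      by (simp add: algebra_simps)
  qed
  then have "F / Z \<le> (F + c * Fk + c * r $ k * Zk) / (Z + c * Zk)"
    using pos by (simp add: divide_le_eq pos_le_divide_eq add_pos_pos mult_ac)
  then show ?thesis
    unfolding expected_profit_eq_quotient[of \<theta> r "insert k S"] num den
    by (simp add: expected_profit_eq_quotient F_def Z_def w_def f_def)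
qed

section \<open>Covariances of the profit on an isolated subgraph\<close>

lemma isolated_no_interaction:
  assumes "transpose \<theta> = \<theta>" and "induces_isolated_subgraph \<theta> H" and "i \<in> H" and "j \<notin> H"
  shows "\<theta> $ i $ j = 0 \<and> \<theta> $ j $ i = 0"
proof -
  have "\<theta> $ i $ j = 0"
    using assms by (auto simp: induces_isolated_subgraph_def ising_edge_def)
  moreover have "\<theta> $ j $ i = \<theta> $ i $ j"
    using assms(1) by (metis transpose_def vec_lambda_beta)
  ultimately show ?thesis by simp
qed

text \<open>The double sum vanishes because the parts of a basket inside and outside \<open>H\<close> are independent:
  exchanging the outside parts of \<open>x\<close> and \<open>y\<close> only reverses the sign of \<open>h x - h y\<close>.\<close>

lemma isolated_covariance_eq_0:
  fixes \<theta> :: "real^'n^'n" and S H :: "'n set" and \<phi> h :: "('n \<Rightarrow> real) \<Rightarrow> real"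
  defines "w \<equiv> \<lambda>x. exp (ising_exponent \<theta> S x)"
  assumes "transpose \<theta> = \<theta>" and "induces_isolated_subgraph \<theta> H"
    and \<phi>: "\<And>x y. (\<And>i. i \<in> S \<inter> H \<Longrightarrow> x i = y i) \<Longrightarrow> \<phi> x = \<phi> y"
    and h: "\<And>x y. (\<And>i. i \<in> S - H \<Longrightarrow> x i = y i) \<Longrightarrow> h x = h y"
  shows "(\<Sum>x\<in>baskets S. \<Sum>y\<in>baskets S. w x * w y * ((\<phi> x - \<phi> y) * (h x - h y))) = 0"
proof -
  define mix :: "('n \<Rightarrow> real) \<Rightarrow> ('n \<Rightarrow> real) \<Rightarrow> 'n \<Rightarrow> real"
    where "mix x y = (\<lambda>i. if i \<in> H then x i else y i)" for x y
  have mix_baskets: "mix x y \<in> baskets S" if "x \<in> baskets S" "y \<in> baskets S" for x y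
    using that by (auto simp: mix_def baskets_def PiE_iff extensional_def)
  have exponent_mix: "ising_exponent \<theta> S (mix x y) = ising_exponent \<theta> (S \<inter> H) x + ising_exponent \<theta> (S - H) y"
    if "x \<in> baskets S" "y \<in> baskets S" for x y
  proof -
    have "ising_exponent \<theta> ((S \<inter> H) \<union> (S - H)) (mix x y)
        = ising_exponent \<theta> (S \<inter> H) (mix x y) + ising_exponent \<theta> (S - H) (mix x y)"
    proof (rule ising_exponent_union)
      show "mix x y i \<in> {0, 1}" if "i \<in> (S \<inter> H) \<union> (S - H)" for i
        using that baskets_values[OF mix_baskets[OF \<open>x \<in> baskets S\<close> \<open>y \<in> baskets S\<close>]] by auto
      show "\<theta> $ i $ j = 0 \<and> \<theta> $ j $ i = 0" if "i \<in> S \<inter> H" "j \<in> S - H" for i j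
        using isolated_no_interaction[OF assms(2,3)] that by simp
    qed auto
    moreover have "(S \<inter> H) \<union> (S - H) = S" by auto
    moreover have "ising_exponent \<theta> (S \<inter> H) (mix x y) = ising_exponent \<theta> (S \<inter> H) x"
      "ising_exponent \<theta> (S - H) (mix x y) = ising_exponent \<theta> (S - H) y"
      by (auto intro!: ising_exponent_cong simp: mix_def)
    ultimately show ?thesis by simp
  qed
  have mix_self: "mix x x = x" for x
    by (auto simp: mix_def)
  have weight: "w (mix x y) * w (mix y x) = w x * w y"
    if "x \<in> baskets S" "y \<in> baskets S" for x y
    using exponent_mix[OF that] exponent_mix[OF that(2,1)]
      exponent_mix[OF that(1) that(1)] exponent_mix[OF that(2) that(2)]
    by (simp add: mix_self w_def flip: exp_add)
  have mix_\<phi>: "\<phi> (mix x y) = \<phi> x" and mix_h: "h (mix x y) = h y" for x y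
    by (auto intro!: \<phi> h simp: mix_def)
  let ?F = "\<lambda>(x, y). w x * w y * ((\<phi> x - \<phi> y) * (h x - h y))"
  have "sum ?F (baskets S \<times> baskets S) = 0"
  proof (rule sum_eq_0_by_involution[where \<tau> = "\<lambda>(x, y). (mix x y, mix y x)"])
    fix p assume "p \<in> baskets S \<times> baskets S"
    then obtain x y where p: "p = (x, y)" and xy: "x \<in> baskets S" "y \<in> baskets S"
      by auto
    show "(\<lambda>(x, y). (mix x y, mix y x)) p \<in> baskets S \<times> baskets S"
      by (simp add: p xy mix_baskets)
    show "(\<lambda>(x, y). (mix x y, mix y x)) ((\<lambda>(x, y). (mix x y, mix y x)) p) = p"
      by (auto simp: p mix_def)
    show "?F ((\<lambda>(x, y). (mix x y, mix y x)) p) = - ?F p"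
      by (simp add: p weight[OF xy] mix_\<phi> mix_h algebra_simps)
  qed
  then show ?thesis
    by (simp add: sum.cartesian_product)
qed

lemma exp_tilt_comonotone:
  fixes \<beta> a b :: real
  assumes "\<beta> \<ge> 0"
  shows "0 \<le> (exp (\<beta> * a) - exp (\<beta> * b)) * (a - b)"
proof (cases "a \<le> b")
  case True
  then show ?thesis
    using assms by (intro mult_nonpos_nonpos) (auto intro: mult_left_mono)
next
  case False
  then show ?thesis
    using assms by (intro mult_nonneg_nonneg) (auto intro: mult_left_mono)
qed

text \<open>Tilting by the profit on \<open>S \<inter> H\<close> favours baskets that are profitable there and leaves the
  profit on \<open>S - H\<close> unaffected.\<close>

lemma isolated_profit_covariance_nonneg:
  fixes \<theta> :: "real^'n^'n" and r :: "real^'n" and S H :: "'n set" and \<beta> :: real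
  defines "w \<equiv> \<lambda>x. exp (ising_exponent \<theta> S x)"
    and "\<phi> \<equiv> \<lambda>x. exp (\<beta> * (\<Sum>i\<in>S \<inter> H. r $ i * x i))"
    and "f \<equiv> \<lambda>x. \<Sum>j\<in>S. r $ j * x j"
  assumes "transpose \<theta> = \<theta>" and "induces_isolated_subgraph \<theta> H" and "\<beta> \<ge> 0"
  shows "(\<Sum>x\<in>baskets S. w x * \<phi> x) * (\<Sum>x\<in>baskets S. w x * f x)
      \<le> (\<Sum>x\<in>baskets S. w x) * (\<Sum>x\<in>baskets S. w x * \<phi> x * f x)"
proof -
  define g where "g x = (\<Sum>i\<in>S \<inter> H. r $ i * x i)" for x :: "'n \<Rightarrow> real"
  define h where "h x = (\<Sum>i\<in>S - H. r $ i * x i)" for x :: "'n \<Rightarrow> real"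
  have f: "f x = g x + h x" for x
    unfolding f_def g_def h_def by (rule sum.Int_Diff) simp
  have "0 \<le> w x * w y * ((\<phi> x - \<phi> y) * (g x - g y))" for x y
    using exp_tilt_comonotone[OF \<open>\<beta> \<ge> 0\<close>, of "g x" "g y"] by (simp add: w_def \<phi>_def g_def)
  then have "0 \<le> (\<Sum>x\<in>baskets S. \<Sum>y\<in>baskets S. w x * w y * ((\<phi> x - \<phi> y) * (g x - g y)))"
    by (intro sum_nonneg)
  moreover have "(\<Sum>x\<in>baskets S. \<Sum>y\<in>baskets S. w x * w y * ((\<phi> x - \<phi> y) * (h x - h y))) = 0"
    unfolding w_def by (rule isolated_covariance_eq_0[OF assms(4,5)])
      (auto simp: \<phi>_def h_def intro!: sum.cong arg_cong[where f = "\<lambda>u. exp (\<beta> * u)"])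
  moreover have "(\<Sum>x\<in>baskets S. \<Sum>y\<in>baskets S. w x * w y * ((\<phi> x - \<phi> y) * (f x - f y)))
      = (\<Sum>x\<in>baskets S. \<Sum>y\<in>baskets S. w x * w y * ((\<phi> x - \<phi> y) * (g x - g y)))
      + (\<Sum>x\<in>baskets S. \<Sum>y\<in>baskets S. w x * w y * ((\<phi> x - \<phi> y) * (h x - h y)))"
    unfolding f sum.distrib[symmetric] by (intro sum.cong refl) (simp add: algebra_simps)
  ultimately have "0 \<le> (\<Sum>x\<in>baskets S. \<Sum>y\<in>baskets S. w x * w y * ((\<phi> x - \<phi> y) * (f x - f y)))"
    by simp
  then show ?thesis
    unfolding double_sum_covariance by simp
qed

section \<open>An optimal assortment containing the product\<close>

lemma optimal_assortment_exists:
  fixes \<theta> :: "real^'n^'n"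
  shows "\<exists>S. optimal_assortment \<theta> r S"
proof -
  have "Max (range (expected_profit \<theta> r)) \<in> range (expected_profit \<theta> r)"
    by (rule Max_in) auto
  then obtain S where "Max (range (expected_profit \<theta> r)) = expected_profit \<theta> r S"
    by blast
  then have "optimal_assortment \<theta> r S"
    unfolding optimal_assortment_def by (metis Max_ge finite finite_imageI rangeI)
  then show ?thesis ..
qed

theorem proposition4:
  fixes \<theta> :: "real^'n^'n" and r :: "real^'n" and H :: "'n set" and k :: 'n and \<alpha> :: real
  assumes "transpose \<theta> = \<theta>"
    and "\<And>j. r $ j \<ge> 0"
    and "induces_isolated_subgraph \<theta> H"
    and "k \<in> H"
    and "\<alpha> > 0"
    and "\<And>i. i \<in> H - {k} \<Longrightarrow> \<theta> $ k $ i = \<alpha> * r $ i"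
  shows "\<exists>S. optimal_assortment \<theta> r S \<and> k \<in> S"
proof -
  obtain S where S: "optimal_assortment \<theta> r S"
    using optimal_assortment_exists by blast
  show ?thesis
  proof (cases "k \<in> S")
    case False
    have tilt: "2 * (\<Sum>i\<in>S. \<theta> $ k $ i * x i) = 2 * \<alpha> * (\<Sum>i\<in>S \<inter> H. r $ i * x i)"
      for x :: "'n \<Rightarrow> real"
    proof -
      have "(\<Sum>i\<in>S. \<theta> $ k $ i * x i)
          = (\<Sum>i\<in>S \<inter> H. \<theta> $ k $ i * x i) + (\<Sum>i\<in>S - H. \<theta> $ k $ i * x i)"
        by (rule sum.Int_Diff) simp
      also have "(\<Sum>i\<in>S - H. \<theta> $ k $ i * x i) = 0"
        using isolated_no_interaction[OF assms(1,3,4)] by (intro sum.neutral) auto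
      also have "(\<Sum>i\<in>S \<inter> H. \<theta> $ k $ i * x i) = (\<Sum>i\<in>S \<inter> H. \<alpha> * (r $ i * x i))"
      proof (intro sum.cong refl)
        fix i assume "i \<in> S \<inter> H"
        then have "i \<in> H - {k}" using False by auto
        then show "\<theta> $ k $ i * x i = \<alpha> * (r $ i * x i)"
          using assms(6) by simp
      qed
      finally show ?thesis
        by (simp flip: sum_distrib_left)
    qed
    have "expected_profit \<theta> r S \<le> expected_profit \<theta> r (insert k S)"
    proof (rule expected_profit_le_insert[OF assms(1,2) False], unfold tilt)
    qed (rule isolated_profit_covariance_nonneg, use assms in auto)
    then have "optimal_assortment \<theta> r (insert k S)"
      using S unfolding optimal_assortment_def by (meson order_trans)
    then show ?thesis by blast
  qed (use S in blast)
qed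

end
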